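(* Let $\mathbb{G}=(\mathbb{V},\mathbb{E})$ be an acyclic connected graph, and let $\mathrm{T}_1\in\mathbb{F}^{M\times N}$ and $\mathrm{T}_2\in\mathbb{F}^{N\times P}$, with $M=\sum_{i\in\mathbb{V}}m_i$, $N=\sum_{i\in\mathbb{V}}n_i$ and $P=\sum_{i\in\mathbb{V}}p_i$, be TQS matrices on $\mathbb{G}$ of rank-profiles $\{\rho_{1,e}\}_{e\in\mathbb{E}}$ and $\{\rho_{2,e}\}_{e\in\mathbb{E}}$ respectively, where $\mathrm{T}_1$ has output dimensions $\{m_i\}$ and input dimensions $\{n_i\}$, and $\mathrm{T}_2$ has output dimensions $\{n_i\}$ and input dimensions $\{p_i\}$. Then $\mathrm{T}_3=\mathrm{T}_1\mathrm{T}_2$ is a TQS matrix on $\mathbb{G}$ (with output dimensions $\{m_i\}$ and input dimensions $\{p_i\}$) of rank-profile $\{\rho_{1,e}+\rho_{2,e}\}_{e\in\mathbb{E}}$.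
   Context: $\mathbb{F}$ is a field. $\mathbb{G}=(\mathbb{V},\mathbb{E})$ is a finite connected acyclic undirected graph (a tree) with $\mathbb{V}=\{1,\dots,K\}$. The edge set $\mathbb{E}$ is regarded as a set of ordered pairs with $(i,j)\in\mathbb{E}$ iff $(j,i)\in\mathbb{E}$ (both orientations of each edge are included; no loops). $\mathcal{N}(i)$ is the set of neighbors of $i$. Any two distinct nodes are joined by a unique (non-self-intersecting) path. Graph-partitioned matrix: each node $i$ has an input dimension $n_i\ge 0$ and an output dimension $m_i\ge 0$ (integers, zero allowed); $M=\sum_i m_i$, $N=\sum_i n_i$. A matrix $\mathrm{T}\in\mathbb{F}^{M\times N}$ is block-partitioned with blocks $\mathrm{T}\{i,j\}\in\mathbb{F}^{m_i\times n_j}$, $i,j\in\mathbb{V}$. TQS matrix: given nonnegative integer weights $\{\rho_e\}_{e\in\mathbb{E}}$ (the rank-profile; $\rho_{(i,j)}$ and $\rho_{(j,i)}$ may differ), $\mathrm{T}$ is a tree quasi-separable (TQS) matrix on $\mathbb{G}$ with input dimensions $\{n_i\}$, output dimensions $\{m_i\}$ and rank-profile $\{\rho_e\}$ if there exist matrices $\mathrm{D}^k\in\mathbb{F}^{m_k\times n_k}$ ($k\in\mathbb{V}$), $\mathrm{Inp}^k_j\in\mathbb{F}^{\rho_{(k,j)}\times n_k}$ ($(k,j)\in\mathbb{E}$), $\mathrm{Trans}^k_{i,j}\in\mathbb{F}^{\rho_{(k,i)}\times\rho_{(j,k)}}$ ($i\neq j$ in $\mathcal{N}(k)$), $\mathrm{Out}^k_i\in\mathbb{F}^{m_k\times\rho_{(i,k)}}$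 ($(i,k)\in\mathbb{E}$) such that $\mathrm{T}\{i,i\}=\mathrm{D}^i$ and, for $i\ne j$ with unique path $j=q_0-q_1-\cdots-q_\nu=i$, $$\mathrm{T}\{i,j\}=\mathrm{Out}^i_{q_{\nu-1}}\,\mathrm{Trans}^{q_{\nu-1}}_{i,q_{\nu-2}}\cdots\mathrm{Trans}^{q_2}_{q_3,q_1}\,\mathrm{Trans}^{q_1}_{q_2,j}\,\mathrm{Inp}^j_{q_1}$$ (for $\nu=1$ this reads $\mathrm{Out}^i_j\,\mathrm{Inp}^j_i$). *)

theory Defs
  imports "Jordan_Normal_Form.Matrix" "Graph_Theory.Graph_Theory"
begin

(* A pair_graph is a finite symmetric loop-free set of arcs, so every edge {u,v} makes the closed
   walk u,v,u a cycle of length 2 in the sense of pre_digraph.cycle (and the library's forest and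
   tree would exclude all edges).  The cycles of the underlying undirected graph are exactly those
   of length at least 3. *)
locale tree_graph = pair_graph G
  for G :: "nat pair_pre_digraph" and K :: nat +
  assumes verts_eq: "pverts G = {1..K}"
    and connected: "Digraph_Component.connected (with_proj G)"
    and acyclic: "\<not> (\<exists>p. pre_digraph.cycle (with_proj G) p \<and> 3 \<le> length p)"

definition neighbors :: "nat pair_pre_digraph \<Rightarrow> nat \<Rightarrow> nat set" where
  "neighbors G k = {j. (k, j) \<in> parcs G}"

(* Number of rows (columns) before block i, when the blocks 1, 2, ... have sizes d 1, d 2, ... *)
definition block_offset :: "(nat \<Rightarrow> nat) \<Rightarrow> nat \<Rightarrow> nat" where
  "block_offset d i = (\<Sum>k\<in>{1..<i}. d k)"

definition mat_block :: "(nat \<Rightarrow> nat) \<Rightarrow> (nat \<Rightarrow> nat) \<Rightarrow> 'a mat \<Rightarrow> nat \<Rightarrow> nat \<Rightarrow> 'a mat" where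
  "mat_block m n T i j =
     mat (m i) (n j) (\<lambda>(a, b). T $$ (block_offset m i + a, block_offset n j + b))"

(* Argument order: D k, Inp k j, Trans k i j and Out k i are the matrices written with superscript
   k and the remaining arguments as subscripts. *)
definition tqs_generator_dims ::
  "nat pair_pre_digraph \<Rightarrow> (nat \<Rightarrow> nat) \<Rightarrow> (nat \<Rightarrow> nat) \<Rightarrow> (nat \<times> nat \<Rightarrow> nat) \<Rightarrow>
   (nat \<Rightarrow> 'a mat) \<Rightarrow> (nat \<Rightarrow> nat \<Rightarrow> 'a mat) \<Rightarrow> (nat \<Rightarrow> nat \<Rightarrow> nat \<Rightarrow> 'a mat) \<Rightarrow>
   (nat \<Rightarrow> nat \<Rightarrow> 'a mat) \<Rightarrow> bool" where
  "tqs_generator_dims G m n \<rho> D Inp Trans Out \<longleftrightarrow>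
     (\<forall>k\<in>pverts G. D k \<in> carrier_mat (m k) (n k)) \<and>
     (\<forall>k j. (k, j) \<in> parcs G \<longrightarrow> Inp k j \<in> carrier_mat (\<rho> (k, j)) (n k)) \<and>
     (\<forall>k\<in>pverts G. \<forall>i\<in>neighbors G k. \<forall>j\<in>neighbors G k. i \<noteq> j \<longrightarrow>
        Trans k i j \<in> carrier_mat (\<rho> (k, i)) (\<rho> (j, k))) \<and>
     (\<forall>k i. (i, k) \<in> parcs G \<longrightarrow> Out k i \<in> carrier_mat (m k) (\<rho> (i, k)))"

(* For a path q = [q0, ..., qv] with v \<ge> 1 edges, from the input node q0 to the output node qv:
   Out^{qv}_{q(v-1)} Trans^{q(v-1)}_{qv,q(v-2)} ... Trans^{q1}_{q2,q0} Inp^{q0}_{q1}. *)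
definition path_product ::
  "(nat \<Rightarrow> nat \<Rightarrow> 'a::field mat) \<Rightarrow> (nat \<Rightarrow> nat \<Rightarrow> nat \<Rightarrow> 'a mat) \<Rightarrow> (nat \<Rightarrow> nat \<Rightarrow> 'a mat) \<Rightarrow>
   nat list \<Rightarrow> 'a mat" where
  "path_product Inp Trans Out q =
     (let v = length q - 1 in
      Out (q ! v) (q ! (v - 1)) *
      foldr (*) (map (\<lambda>l. Trans (q ! l) (q ! (l + 1)) (q ! (l - 1))) (rev [1..<v]))
        (Inp (q ! 0) (q ! 1)))"

(* m: output dimensions (block rows), n: input dimensions (block columns), \<rho>: rank-profile.
   Intended for G a tree, where the path q from j to i exists and is unique. *)
definition is_tqs ::
  "nat pair_pre_digraph \<Rightarrow> (nat \<Rightarrow> nat) \<Rightarrow> (nat \<Rightarrow> nat) \<Rightarrow> (nat \<times> nat \<Rightarrow> nat) \<Rightarrow>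
   'a::field mat \<Rightarrow> bool" where
  "is_tqs G m n \<rho> T \<longleftrightarrow>
     T \<in> carrier_mat (\<Sum>i\<in>pverts G. m i) (\<Sum>i\<in>pverts G. n i) \<and>
     (\<exists>D Inp Trans Out.
        tqs_generator_dims G m n \<rho> D Inp Trans Out \<and>
        (\<forall>i\<in>pverts G. mat_block m n T i i = D i) \<and>
        (\<forall>i\<in>pverts G. \<forall>j\<in>pverts G. i \<noteq> j \<longrightarrow>
           (\<forall>q. vpath q (with_proj G) \<and> hd q = j \<and> last q = i \<longrightarrow>
              mat_block m n T i j = path_product Inp Trans Out q)))"

end

theory Submission
  imports Defs
begin

text \<open>
  Deleting an edge \<open>(a, b)\<close> of a tree splits the nodes into the side of \<open>a\<close> and the side of \<open>b\<close>.
  A TQS representation amounts to one factorization per directed edge: for \<open>j\<close> on the side of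
  \<open>a\<close> and \<open>i\<close> on the side of \<open>b\<close>, the block \<open>T{i,j}\<close> equals \<open>\<Psi> a b i * \<Phi> a b j\<close>, where
  \<open>\<Phi> a b j\<close> maps the input at \<open>j\<close> to the state carried by the edge and \<open>\<Psi> a b i\<close> maps that state to
  the output at \<open>i\<close>. The factors of consecutive edges are linked by
  \<open>\<Phi> k i l = Trans k i j * \<Phi> j k l\<close>. The generators give such factors by cutting each path product
  at the edge (\<open>edge_factorization_if_tqs\<close>). Conversely, \<open>Inp\<close> and \<open>Out\<close> can be read off as the factors
  at the two end points of an edge, and the link rebuilds the path products
  (\<open>tqs_if_edge_factorization\<close>).

  In this form the product is easy. For \<open>j\<close> and \<open>i\<close> on the two sides of \<open>(a, b)\<close>, split the sum
  \<open>\<Sum>k. T\<^sub>1{i,k} * T\<^sub>2{k,j}\<close> according to the side of \<open>k\<close>. If \<open>k\<close> is on the side of \<open>a\<close>, then \<open>T\<^sub>1{i,k}\<close>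
  factors through the edge; if \<open>k\<close> is on the side of \<open>b\<close>, then \<open>T\<^sub>2{k,j}\<close> does. Hence the block is
  \<open>\<Psi>\<^sub>1(i) * (\<Sum>k near a. \<Phi>\<^sub>1(k) * T\<^sub>2{k,j}) + (\<Sum>k near b. T\<^sub>1{i,k} * \<Psi>\<^sub>2(k)) * \<Phi>\<^sub>2(j)\<close>,
  a factorization whose state space stacks those of \<open>T\<^sub>1\<close> and \<open>T\<^sub>2\<close> and so has dimension
  \<open>\<rho>\<^sub>1 + \<rho>\<^sub>2\<close>. From an edge \<open>(j, k)\<close> to the next edge \<open>(k, i)\<close> the new state is a linear function of
  the old one: the sum over the side of \<open>k\<close> gains the nodes that branch off at \<open>k\<close>, and for those
  nodes \<open>T\<^sub>2{r,l} = \<Psi>\<^sub>2(r) * \<Phi>\<^sub>2(l)\<close> across \<open>(j, k)\<close>. The transition matrix is therefore block upper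
  triangular (\<open>edge_factorization_mult\<close>).
\<close>

section \<open>Paths in a tree and the two sides of an edge\<close>

lemma vwalk_append_iff:
  assumes "p \<noteq> []" "q \<noteq> []"
  shows "vwalk (p @ q) G \<longleftrightarrow> vwalk p G \<and> vwalk q G \<and> (last p, hd q) \<in> arcs_ends G"
  using assms by (auto simp: vwalk_def vwalk_arcs_append)

context tree_graph
begin

abbreviation tpath :: "nat list \<Rightarrow> bool" where
  "tpath q \<equiv> vpath q (with_proj G)"

lemma arc_sym: "(a, b) \<in> parcs G \<Longrightarrow> (b, a) \<in> parcs G"
  by (rule arcs_symmetric)

lemma arc_neq: "(a, b) \<in> parcs G \<Longrightarrow> a \<noteq> b"
  using pair_no_loops by fastforce

lemma tpath_single: "tpath [x] \<longleftrightarrow> x \<in> pverts G"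
  by (auto simp: vpath_def vwalk_def)

lemma tpath_Cons_Cons:
  "tpath (x # y # ys) \<longleftrightarrow> (x, y) \<in> parcs G \<and> x \<notin> set (y # ys) \<and> tpath (y # ys)"
  by (auto simp: vpath_def vwalk_def dest: in_arcsD1)

lemma vwalk_rev: "vwalk q (with_proj G) \<Longrightarrow> vwalk (rev q) (with_proj G)"
  unfolding vwalk_def set_vwalk_arcs_rev set_rev rev_is_Nil_conv with_proj_simps
  by (blast intro: arc_sym)

lemma tpath_rev: "tpath (rev q) \<longleftrightarrow> tpath q"
  using vwalk_rev[of q] vwalk_rev[of "rev q"] by (auto simp: vpath_def)

lemma tpath_edge: "(a, b) \<in> parcs G \<Longrightarrow> tpath [a, b]"
  using arc_neq[of a b] in_arcsD2[of a b] by (simp add: tpath_Cons_Cons tpath_single)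

lemma tpath_exists:
  assumes "x \<in> pverts G" "y \<in> pverts G"
  obtains q where "tpath q" "hd q = x" "last q = y"
proof -
  have sym: "symmetric (with_proj G)" by (rule pair_sym_arcs)
  have "x \<rightarrow>\<^sup>*\<^bsub>mk_symmetric (with_proj G)\<^esub> y"
    using connected assms by (auto simp: connected_def strongly_connected_def)
  then have "x \<rightarrow>\<^sup>*\<^bsub>with_proj G\<^esub> y"
    by (simp only: reachable_mk_symmetric_eq[OF sym])
  then show thesis using that reachable_vpath_conv by blast
qed

lemma vwalk_arcs_awalk:
  "vwalk q (with_proj G) \<Longrightarrow>
     awalk (hd q) (vwalk_arcs q) (last q) \<and> pawalk_verts (hd q) (vwalk_arcs q) = q"
proof (induction q rule: vwalk_arcs.induct)
  case (3 x y xs)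
  then show ?case by (auto simp: awalk_Cons_iff vwalk_def)
qed (auto simp: vwalk_def awalk_Nil_iff)

text \<open>A walk avoiding \<open>x\<close> between two different neighbours of \<open>x\<close> would shrink to a path, and going
  through \<open>x\<close> closes that path to a cycle of length at least 3.\<close>

lemma no_detour:
  assumes w: "vwalk w (with_proj G)" and x: "x \<notin> set w"
    and arcs: "(x, hd w) \<in> parcs G" "(last w, x) \<in> parcs G"
  shows "hd w = last w"
proof (rule ccontr)
  assume ne: "hd w \<noteq> last w"
  define q where "q = vwalk_to_vpath w"
  have q: "tpath q" "hd q = hd w" "last q = last w" "x \<notin> set q"
    using w x by (auto simp: q_def vwalk_to_vpath_vpath vwalk_to_vpath_hd vwalk_to_vpath_last
        dest: vwalk_to_vpath_subset)
  then have "q \<noteq> []" by (auto simp: vpath_def vwalk_def)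
  have walk: "vwalk (x # q @ [x]) (with_proj G)"
    using q arcs \<open>q \<noteq> []\<close>
    by (auto simp: vpath_def vwalk_def vwalk_arcs_append dest: in_arcsD1)
  have "length q \<ge> 2"
    using ne q \<open>q \<noteq> []\<close> by (cases q rule: vwalk_arcs.cases) auto
  then have "3 \<le> length (vwalk_arcs (x # q @ [x]))"
    using vwalk_length_simp[of "x # q @ [x]"] unfolding vwalk_length_def by simp
  moreover have "cycle (vwalk_arcs (x # q @ [x]))"
    using vwalk_arcs_awalk[OF walk] q \<open>q \<noteq> []\<close> unfolding cycle_def
    by (intro exI[of _ x]) (auto simp: vpath_def)
  ultimately show False using acyclic by blast
qed

text \<open>If two paths between the same end points left \<open>x\<close> through different neighbours, then following
  one of them forwards and the other backwards would give a detour around \<open>x\<close>. So the first steps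
  agree, and induction does the rest.\<close>

lemma tpath_unique:
  "tpath p \<Longrightarrow> tpath q \<Longrightarrow> hd p = hd q \<Longrightarrow> last p = last q \<Longrightarrow> p = q"
proof (induction p arbitrary: q rule: vwalk_arcs.induct)
  case 1
  then show ?case by (auto simp: vpath_def vwalk_def)
next
  case (2 x)
  then show ?case by (cases q rule: vwalk_arcs.cases) (auto simp: vpath_def vwalk_def split: if_splits)
next
  case (3 x y ps)
  show ?case
  proof (cases q rule: vwalk_arcs.cases)
    case 1
    then show ?thesis using "3.prems" by (auto simp: vpath_def vwalk_def)
  next
    case 2
    then show ?thesis using "3.prems" by (auto simp: vpath_def split: if_splits)
  next
    case q: (3 x' z qs)
    have [simp]: "x' = x" using "3.prems" q by simp
    have p1: "tpath (y # ps)" "(x, y) \<in> parcs G" "x \<notin> set (y # ps)"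
      and q1: "tpath (z # qs)" "(x, z) \<in> parcs G" "x \<notin> set (z # qs)"
      using "3.prems" q by (auto simp: tpath_Cons_Cons)
    have l: "last (y # ps) = last (z # qs)" using "3.prems" q by simp
    let ?w = "vwalk_join (y # ps) (rev (z # qs))"
    have j: "joinable (y # ps) (rev (z # qs))" using l
      by (intro joinableI) (auto simp: hd_rev simp del: last.simps rev.simps)
    have w: "vwalk ?w (with_proj G)"
      using p1(1) q1(1) j by (intro vwalk_joinI_vwalk vwalk_rev) (auto simp: vpath_def)
    have hw: "hd ?w = y" using vwalk_join_hd[OF j] by simp
    have lw: "last ?w = z" using vwalk_join_last[OF j] by simp
    have "x \<notin> set ?w"
      using p1(3) q1(3) list.set_sel(2)[of "rev (z # qs)" x] unfolding vwalk_join_def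
      by (auto simp del: rev.simps)
    then have "y = z" using no_detour[OF w] p1(2) arc_sym[OF q1(2)] unfolding hw lw by blast
    then show ?thesis using "3.IH"[OF p1(1) q1(1)] l q by simp
  qed
qed

text \<open>For an edge \<open>(a, b)\<close>, the component of \<open>a\<close> in the tree without that edge: the nodes reached from
  \<open>b\<close> by a path whose first step goes to \<open>a\<close>. The list form makes a path to \<open>k\<close> in this component
  available together with the membership of \<open>k\<close>.\<close>

definition side :: "nat \<Rightarrow> nat \<Rightarrow> nat set" where
  "side a b = {k. \<exists>xs. tpath (b # a # xs) \<and> last (a # xs) = k}"

lemma side_self:
  assumes "(a, b) \<in> parcs G"
  shows "a \<in> side a b"
proof -
  have "tpath [b, a]" by (rule tpath_edge[OF arc_sym[OF assms]])
  moreover have "last [a] = a" by simp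
  ultimately show ?thesis unfolding side_def by blast
qed

lemma side_subset: "side a b \<subseteq> pverts G"
proof
  fix k assume "k \<in> side a b"
  then obtain xs where p: "tpath (b # a # xs)" "last (a # xs) = k" by (auto simp: side_def)
  have "k \<in> set (a # xs)" unfolding p(2)[symmetric] by (rule last_in_set) simp
  then show "k \<in> pverts G" using p(1) unfolding vpath_def vwalk_def by auto
qed

lemma tpath_prefix: "tpath (us @ vs) \<Longrightarrow> us \<noteq> [] \<Longrightarrow> tpath us"
  unfolding vpath_def by (meson distinct_append vwalkI_append_l)

lemma tpath_in_side:
  assumes p: "tpath (b # a # xs)" and v: "v \<in> set (a # xs)"
  shows "v \<in> side a b"
proof -
  obtain us vs where s: "a # xs = us @ v # vs" using v by (meson split_list)
  then obtain ys where ys: "us @ [v] = a # ys" by (cases us) auto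
  have "tpath ((b # us @ [v]) @ vs)" using p s by simp
  then have "tpath (b # a # ys)" unfolding ys by (rule tpath_prefix) simp
  moreover have "last (a # ys) = v" unfolding ys[symmetric] by simp
  ultimately show ?thesis unfolding side_def by blast
qed

lemma side_disjoint: "side a b \<inter> side b a = {}"
proof (rule equals0I)
  fix k assume "k \<in> side a b \<inter> side b a"
  then obtain xs ys where x: "tpath (b # a # xs)" "last (a # xs) = k"
    and y: "tpath (a # b # ys)" "last (b # ys) = k" by (auto simp: side_def)
  have "tpath (a # xs)" using x(1) by (simp add: tpath_Cons_Cons)
  then have "a # xs = a # b # ys"
    by (rule tpath_unique[OF _ y(1)]) (use x y in simp_all)
  then show False using x(1) by (auto simp: vpath_def)
qed

text \<open>The path from \<open>a\<close> to a node \<open>k\<close> either misses \<open>b\<close>, and then \<open>b\<close> can be put in front of it, or it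
  contains \<open>b\<close>; in the latter case its initial part up to \<open>b\<close> is the edge itself, by uniqueness of
  paths.\<close>

lemma side_union:
  assumes ab: "(a, b) \<in> parcs G"
  shows "side a b \<union> side b a = pverts G"
proof -
  have "k \<in> side a b \<union> side b a" if k: "k \<in> pverts G" for k
  proof -
    obtain q where q: "tpath q" "hd q = a" "last q = k"
      by (rule tpath_exists[OF in_arcsD1[OF ab] k])
    then obtain xs where xs: "q = a # xs" by (cases q) (auto simp: vpath_def vwalk_def)
    show ?thesis
    proof (cases "b \<in> set xs")
      case False
      then have "tpath (b # a # xs)"
        using q(1) arc_sym[OF ab] arc_neq[OF ab] unfolding xs tpath_Cons_Cons by simp
      then show ?thesis using q(3) unfolding xs side_def by blast
    next
      case True
      then obtain us vs where s: "xs = us @ b # vs" by (meson split_list)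
      have "tpath (a # us @ [b])"
        using q(1) tpath_prefix[of "a # us @ [b]" vs] by (simp add: xs s)
      then have "a # us @ [b] = [a, b]" by (rule tpath_unique[OF _ tpath_edge[OF ab]]) auto
      then have "q = a # b # vs" using xs s by simp
      then have "tpath (a # b # vs)" "last (b # vs) = k" using q by auto
      then show ?thesis unfolding side_def by blast
    qed
  qed
  then show ?thesis using side_subset by blast
qed

lemma side_neighbors_disjoint:
  assumes "i \<noteq> j"
  shows "side i k \<inter> side j k = {}"
proof (rule equals0I)
  fix l assume "l \<in> side i k \<inter> side j k"
  then obtain xs ys where x: "tpath (k # i # xs)" "last (i # xs) = l"
    and y: "tpath (k # j # ys)" "last (j # ys) = l" by (auto simp: side_def)
  then have "k # i # xs = k # j # ys" by (intro tpath_unique) auto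
  then show False using assms by simp
qed

text \<open>A path that leaves \<open>k\<close> towards \<open>j\<close> stays among the nodes behind \<open>j\<close> and cannot meet another
  neighbour of \<open>k\<close>.\<close>

lemma tpath_extend:
  assumes ki: "(k, i) \<in> parcs G" and "i \<noteq> j" and p: "tpath (k # j # xs)"
  shows "tpath (i # k # j # xs)"
proof -
  have "i \<notin> set (j # xs)"
    using tpath_in_side[OF p] side_self[OF arc_sym[OF ki]] side_neighbors_disjoint[OF \<open>i \<noteq> j\<close>, of k]
    by blast
  then show ?thesis using p arc_sym[OF ki] arc_neq[OF ki] by (auto simp: tpath_Cons_Cons)
qed

lemma side_mono:
  assumes "(k, i) \<in> parcs G" "i \<noteq> j"
  shows "side j k \<subseteq> side k i"
proof
  fix l assume "l \<in> side j k"
  then obtain xs where "tpath (k # j # xs)" "last (j # xs) = l"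
    unfolding side_def by blast
  then have "tpath (i # k # j # xs)" "last (k # j # xs) = l"
    using tpath_extend[OF assms] by simp_all
  then show "l \<in> side k i" unfolding side_def by blast
qed

lemma tpath_glue:
  assumes x: "tpath (b # a # xs)" and y: "tpath (a # b # ys)"
  shows "tpath (rev (a # xs) @ b # ys)"
proof -
  have disj: "set (rev (a # xs)) \<inter> set (b # ys) = {}"
  proof (rule equals0I)
    fix v assume "v \<in> set (rev (a # xs)) \<inter> set (b # ys)"
    then have "v \<in> side a b \<inter> side b a"
      using tpath_in_side[OF x, of v] tpath_in_side[OF y, of v] by simp
    then show False by (simp add: side_disjoint)
  qed
  have p: "tpath (rev (a # xs))" "tpath (b # ys)" "(a, b) \<in> parcs G"
    using x y unfolding tpath_rev by (simp_all add: tpath_Cons_Cons)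
  show ?thesis
    unfolding vpath_def
  proof
    show "vwalk (rev (a # xs) @ b # ys) (with_proj G)"
      using p by (subst vwalk_append_iff) (simp_all add: vpath_def)
    show "distinct (rev (a # xs) @ b # ys)"
      using p disj by (simp only: distinct_append vpath_def)
  qed
qed

end

section \<open>Block matrices\<close>

text \<open>Matrices of varying dimensions form no additive monoid, so a sum of matrices is taken
  entrywise, with its dimensions given explicitly so that the empty sum is the zero matrix of that
  shape.\<close>

definition msum :: "nat \<Rightarrow> nat \<Rightarrow> ('k \<Rightarrow> 'a::comm_monoid_add mat) \<Rightarrow> 'k set \<Rightarrow> 'a mat" where
  "msum nr nc f S = mat nr nc (\<lambda>ij. \<Sum>k\<in>S. f k $$ ij)"

lemma msum_carrier [simp]: "msum nr nc f S \<in> carrier_mat nr nc"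
  by (simp add: msum_def)

lemma msum_cong: "(\<And>k. k \<in> S \<Longrightarrow> f k = g k) \<Longrightarrow> msum nr nc f S = msum nr nc g S"
  by (simp add: msum_def)

lemma msum_union:
  "finite S \<Longrightarrow> finite U \<Longrightarrow> S \<inter> U = {} \<Longrightarrow>
     msum nr nc f (S \<union> U) = msum nr nc f S + msum nr nc f U"
  by (rule eq_matI) (auto simp: msum_def sum.union_disjoint)

lemma mult_msum:
  fixes A :: "'a::semiring_0 mat"
  assumes A: "A \<in> carrier_mat nr n" and f: "\<And>k. k \<in> S \<Longrightarrow> f k \<in> carrier_mat n nc"
  shows "A * msum n nc f S = msum nr nc (\<lambda>k. A * f k) S"
proof (rule eq_matI, goal_cases)
  case (1 i j)
  then have i: "i < nr" and j: "j < nc" by (auto simp: msum_def)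
  have "(A * msum n nc f S) $$ (i, j) = (\<Sum>c = 0..<n. \<Sum>k\<in>S. A $$ (i, c) * f k $$ (c, j))"
    using A i j by (simp add: scalar_prod_def msum_def sum_distrib_left)
  also have "\<dots> = (\<Sum>k\<in>S. \<Sum>c = 0..<n. A $$ (i, c) * f k $$ (c, j))"
    by (rule sum.swap)
  also have "\<dots> = (\<Sum>k\<in>S. (A * f k) $$ (i, j))"
    using A i j f by (intro sum.cong) (auto simp: scalar_prod_def dest!: f)
  finally show ?case using i j by (simp add: msum_def)
qed (use A in \<open>auto simp: msum_def\<close>)

lemma msum_mult:
  fixes A :: "'a::semiring_0 mat"
  assumes A: "A \<in> carrier_mat n nc" and f: "\<And>k. k \<in> S \<Longrightarrow> f k \<in> carrier_mat nr n"
  shows "msum nr n f S * A = msum nr nc (\<lambda>k. f k * A) S"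
proof (rule eq_matI, goal_cases)
  case (1 i j)
  then have i: "i < nr" and j: "j < nc" by (auto simp: msum_def)
  have "(msum nr n f S * A) $$ (i, j) = (\<Sum>c = 0..<n. \<Sum>k\<in>S. f k $$ (i, c) * A $$ (c, j))"
    using A i j by (simp add: scalar_prod_def msum_def sum_distrib_right)
  also have "\<dots> = (\<Sum>k\<in>S. \<Sum>c = 0..<n. f k $$ (i, c) * A $$ (c, j))"
    by (rule sum.swap)
  also have "\<dots> = (\<Sum>k\<in>S. (f k * A) $$ (i, j))"
    using A i j f by (intro sum.cong) (auto simp: scalar_prod_def dest!: f)
  finally show ?case using i j by (simp add: msum_def)
qed (use A in \<open>auto simp: msum_def\<close>)

lemma four_block_mult_append_rows:
  fixes A :: "'a::semiring_0 mat"
  assumes "A \<in> carrier_mat nr1 n1" "B \<in> carrier_mat nr1 n2"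
    "C \<in> carrier_mat nr2 n1" "D \<in> carrier_mat nr2 n2"
    "X \<in> carrier_mat n1 nc" "Y \<in> carrier_mat n2 nc"
  shows "four_block_mat A B C D * (X @\<^sub>r Y) = (A * X + B * Y) @\<^sub>r (C * X + D * Y)"
proof -
  have XY: "X @\<^sub>r Y = four_block_mat X (0\<^sub>m n1 0) Y (0\<^sub>m n2 0)"
    using assms by (auto simp: append_rows_def)
  have "four_block_mat A B C D * (X @\<^sub>r Y) =
      four_block_mat (A * X + B * Y) (A * 0\<^sub>m n1 0 + B * 0\<^sub>m n2 0)
        (C * X + D * Y) (C * 0\<^sub>m n1 0 + D * 0\<^sub>m n2 0)"
    unfolding XY by (rule mult_four_block_mat[OF assms(1-4)]) (use assms in auto)
  also have "\<dots> = (A * X + B * Y) @\<^sub>r (C * X + D * Y)"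
    using assms by (intro eq_matI) (auto simp: append_rows_def)
  finally show ?thesis .
qed

definition append_cols :: "'a::zero mat \<Rightarrow> 'a mat \<Rightarrow> 'a mat" where
  "append_cols A B = four_block_mat A B (0\<^sub>m 0 (dim_col A)) (0\<^sub>m 0 (dim_col B))"

lemma append_cols_carrier:
  "A \<in> carrier_mat nr n1 \<Longrightarrow> B \<in> carrier_mat nr n2 \<Longrightarrow> append_cols A B \<in> carrier_mat nr (n1 + n2)"
  unfolding append_cols_def carrier_mat_def by auto

lemma append_cols_mult_append_rows:
  fixes A :: "'a::semiring_0 mat"
  assumes "A \<in> carrier_mat nr n1" "B \<in> carrier_mat nr n2"
    "X \<in> carrier_mat n1 nc" "Y \<in> carrier_mat n2 nc"
  shows "append_cols A B * (X @\<^sub>r Y) = A * X + B * Y"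
proof -
  have "append_cols A B * (X @\<^sub>r Y) = (A * X + B * Y) @\<^sub>r (0\<^sub>m 0 n1 * X + 0\<^sub>m 0 n2 * Y)"
    unfolding append_cols_def using assms four_block_mult_append_rows[of A nr n1 B n2 "0\<^sub>m 0 n1" 0 "0\<^sub>m 0 n2" X nc Y]
    by auto
  also have "\<dots> = A * X + B * Y"
    using assms by (intro eq_matI) (auto simp: append_rows_def)
  finally show ?thesis .
qed

text \<open>Splitting the inner index of a matrix product into consecutive blocks.\<close>

lemma sum_block_offset:
  fixes f :: "nat \<Rightarrow> 'a::comm_monoid_add"
  shows "(\<Sum>c = 0..<(\<Sum>i\<in>{1..K}. d i). f c) = (\<Sum>i\<in>{1..K}. \<Sum>c = 0..<d i. f (block_offset d i + c))"
proof (induction K)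
  case (Suc K)
  let ?s = "\<Sum>i\<in>{1..K}. d i"
  have off: "block_offset d (Suc K) = ?s"
    by (simp add: block_offset_def atLeastLessThanSuc_atLeastAtMost)
  have "(\<Sum>c = 0..<?s + d (Suc K). f c) = (\<Sum>c = 0..<?s. f c) + (\<Sum>c = ?s..<?s + d (Suc K). f c)"
    by (simp add: sum.atLeastLessThan_concat)
  also have "(\<Sum>c = ?s..<?s + d (Suc K). f c) = (\<Sum>c = 0..<d (Suc K). f (?s + c))"
    using sum.shift_bounds_nat_ivl[of f 0 ?s "d (Suc K)"] by (simp add: add.commute)
  finally show ?case using Suc off by simp
qed simp

lemma block_offset_less:
  assumes "i \<in> {1..K}" "a < d i"
  shows "block_offset d i + a < (\<Sum>k\<in>{1..K}. d k)"
proof -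
  have "block_offset d i + d i = sum d (insert i {1..<i})"
    by (simp add: block_offset_def)
  also have "\<dots> \<le> (\<Sum>k\<in>{1..K}. d k)"
    using assms by (intro sum_mono2) auto
  finally show ?thesis using assms by simp
qed

lemma mat_block_carrier [simp]: "mat_block m n T i j \<in> carrier_mat (m i) (n j)"
  by (simp add: mat_block_def)

lemma mat_block_mult:
  fixes T\<^sub>1 T\<^sub>2 :: "'a::semiring_0 mat"
  assumes T1: "T\<^sub>1 \<in> carrier_mat (\<Sum>k\<in>{1..K}. m k) (\<Sum>k\<in>{1..K}. n k)"
    and T2: "T\<^sub>2 \<in> carrier_mat (\<Sum>k\<in>{1..K}. n k) (\<Sum>k\<in>{1..K}. p k)"
    and i: "i \<in> {1..K}" and j: "j \<in> {1..K}"
  shows "mat_block m p (T\<^sub>1 * T\<^sub>2) i j =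
    msum (m i) (p j) (\<lambda>k. mat_block m n T\<^sub>1 i k * mat_block n p T\<^sub>2 k j) {1..K}"
proof (rule eq_matI, goal_cases)
  case (1 a b)
  then have a: "a < m i" and b: "b < p j" by (auto simp: msum_def)
  let ?a = "block_offset m i + a" and ?b = "block_offset p j + b"
  have "(T\<^sub>1 * T\<^sub>2) $$ (?a, ?b) = (\<Sum>c = 0..<(\<Sum>k\<in>{1..K}. n k). T\<^sub>1 $$ (?a, c) * T\<^sub>2 $$ (c, ?b))"
    using T1 T2 block_offset_less[OF i, of a m] block_offset_less[OF j, of b p] a b
    by (simp add: scalar_prod_def)
  also have "\<dots> = (\<Sum>k\<in>{1..K}. \<Sum>c = 0..<n k. T\<^sub>1 $$ (?a, block_offset n k + c) * T\<^sub>2 $$ (block_offset n k + c, ?b))"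
    by (rule sum_block_offset)
  finally show ?case using a b by (simp add: mat_block_def msum_def scalar_prod_def)
qed (auto simp: msum_def mat_block_def)

section \<open>Cutting a path product at an edge\<close>

text \<open>Both functions multiply the generators along one half of a path that crosses an edge between
  \<open>a\<close> and \<open>b\<close>. Each list starts at the end of the edge that belongs to the other half: \<open>b # a # \<dots>\<close>
  runs against the flow, back to the input node, and yields the map from that input to the state on
  \<open>(a, b)\<close>; \<open>a # b # \<dots>\<close> runs with the flow, to the output node, and yields the map from that state
  to the output. In both, moving the cut by one edge changes the head of the list, so that the
  recursion moves one transition matrix from one half to the other.\<close>

fun state_prod :: "(nat \<Rightarrow> nat \<Rightarrow> 'a::semiring_0 mat) \<Rightarrow> (nat \<Rightarrow> nat \<Rightarrow> nat \<Rightarrow> 'a mat) \<Rightarrow> nat list \<Rightarrow> 'a mat"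
  where
    "state_prod Inp Trans [b, a] = Inp a b"
  | "state_prod Inp Trans (b # a # c # xs) = Trans a b c * state_prod Inp Trans (a # c # xs)"

fun obs_prod :: "(nat \<Rightarrow> nat \<Rightarrow> 'a::semiring_0 mat) \<Rightarrow> (nat \<Rightarrow> nat \<Rightarrow> nat \<Rightarrow> 'a mat) \<Rightarrow> nat list \<Rightarrow> 'a mat"
  where
    "obs_prod Out Trans [a, b] = Out b a"
  | "obs_prod Out Trans (a # b # c # ys) = obs_prod Out Trans (b # c # ys) * Trans b c a"

text \<open>The product of all factors of a path product except the leftmost one, which is the output
  map at the end of the path.\<close>

lemma state_prod_foldr:
  "foldr (*) (map (\<lambda>l. Trans (rev (b # a # xs) ! l) (rev (b # a # xs) ! (l + 1)) (rev (b # a # xs) ! (l - 1)))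
       (rev [1..<length xs + 1])) (Inp (rev (b # a # xs) ! 0) (rev (b # a # xs) ! 1)) =
   state_prod Inp Trans (b # a # xs)"
proof (induction xs arbitrary: a b)
  case (Cons c xs)
  let ?q = "rev (a # c # xs)"
  have nth: "(?q @ [b]) ! l = ?q ! l" if "l \<le> length xs + 1" for l
    using that by (simp only: nth_append) simp
  have top: "(?q @ [b]) ! (length xs + 1) = a" "(?q @ [b]) ! (length xs + 2) = b"
    "(?q @ [b]) ! length xs = c"
    by (simp_all add: nth_append)
  have ivl: "rev [1..<length (c # xs) + 1] = (length xs + 1) # rev [1..<length xs + 1]"
    by simp
  have map: "map (\<lambda>l. Trans ((?q @ [b]) ! l) ((?q @ [b]) ! (l + 1)) ((?q @ [b]) ! (l - 1))) (rev [1..<length xs + 1])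
      = map (\<lambda>l. Trans (?q ! l) (?q ! (l + 1)) (?q ! (l - 1))) (rev [1..<length xs + 1])"
  proof (rule map_cong[OF refl])
    fix l assume "l \<in> set (rev [1..<length xs + 1])"
    then have "l \<le> length xs" by auto
    then show "Trans ((?q @ [b]) ! l) ((?q @ [b]) ! (l + 1)) ((?q @ [b]) ! (l - 1)) =
        Trans (?q ! l) (?q ! (l + 1)) (?q ! (l - 1))"
      using nth[of l] nth[of "l + 1"] nth[of "l - 1"] by (simp del: rev.simps)
  qed
  have q: "rev (b # a # c # xs) = ?q @ [b]" by simp
  have "foldr (*) (map (\<lambda>l. Trans ((?q @ [b]) ! l) ((?q @ [b]) ! (l + 1)) ((?q @ [b]) ! (l - 1)))
      ((length xs + 1) # rev [1..<length xs + 1])) (Inp ((?q @ [b]) ! 0) ((?q @ [b]) ! 1)) =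
    Trans a b c * foldr (*) (map (\<lambda>l. Trans (?q ! l) (?q ! (l + 1)) (?q ! (l - 1))) (rev [1..<length xs + 1]))
      (Inp (?q ! 0) (?q ! 1))"
    using nth[of 0] nth[of 1] top unfolding list.map(2) foldr.simps comp_def map
    by (simp del: rev.simps)
  then show ?case unfolding Cons.IH q ivl by simp
qed simp

lemma path_product_state:
  "path_product Inp Trans Out (rev (b # a # xs)) = Out b a * state_prod Inp Trans (b # a # xs)"
proof -
  have "rev (b # a # xs) ! (length xs + 1) = b" "rev (b # a # xs) ! length xs = a"
    by (simp_all add: nth_append)
  then show ?thesis
    using state_prod_foldr[of Trans b a xs Inp]
    unfolding path_product_def Let_def by (simp del: rev.simps)
qed

context tree_graph
begin

lemma state_prod_carrier:
  assumes g: "tqs_generator_dims G m n \<rho> D Inp Trans Out"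
  shows "tpath (b # a # xs) \<Longrightarrow> state_prod Inp Trans (b # a # xs) \<in> carrier_mat (\<rho> (a, b)) (n (last (a # xs)))"
proof (induction xs arbitrary: a b)
  case Nil
  then have "(a, b) \<in> parcs G" by (auto simp: tpath_Cons_Cons dest: arc_sym)
  then show ?case using g by (simp add: tqs_generator_dims_def)
next
  case (Cons c xs)
  then have p: "tpath (a # c # xs)" "(a, b) \<in> parcs G" "(a, c) \<in> parcs G" "b \<noteq> c"
    using arc_sym[of b a] by (simp_all add: tpath_Cons_Cons)
  then have "Trans a b c \<in> carrier_mat (\<rho> (a, b)) (\<rho> (c, a))"
    using g in_arcsD1[of a b] by (simp add: tqs_generator_dims_def neighbors_def)
  then show ?case using Cons.IH[OF p(1)] by simp
qed

lemma obs_prod_carrier: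
  assumes g: "tqs_generator_dims G m n \<rho> D Inp Trans Out"
  shows "tpath (a # b # ys) \<Longrightarrow> obs_prod Out Trans (a # b # ys) \<in> carrier_mat (m (last (b # ys))) (\<rho> (a, b))"
proof (induction ys arbitrary: a b)
  case Nil
  then show ?case using g by (simp add: tpath_Cons_Cons tqs_generator_dims_def)
next
  case (Cons c ys)
  then have p: "tpath (b # c # ys)" "(b, a) \<in> parcs G" "(b, c) \<in> parcs G" "c \<noteq> a"
    using arc_sym[of a b] by (simp_all add: tpath_Cons_Cons)
  then have "Trans b c a \<in> carrier_mat (\<rho> (b, c)) (\<rho> (a, b))"
    using g in_arcsD1[of b a] by (simp add: tqs_generator_dims_def neighbors_def)
  then show ?case using Cons.IH[OF p(1)] by simp
qed

text \<open>The cut starts at the last edge of the path, where only \<open>Out\<close> is split off, and moves towards the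
  input: each step carries one transition matrix over by associativity.\<close>

lemma path_product_cut:
  assumes g: "tqs_generator_dims G m n \<rho> D Inp Trans Out"
  shows "tpath (b # a # xs) \<Longrightarrow> tpath (a # b # ys) \<Longrightarrow>
    path_product Inp Trans Out (rev (a # xs) @ b # ys) =
    obs_prod Out Trans (a # b # ys) * state_prod Inp Trans (b # a # xs)"
proof (induction ys arbitrary: a b xs)
  case Nil
  then show ?case using path_product_state[of Inp Trans Out b a xs] by simp
next
  case (Cons c ys)
  have p: "tpath (b # c # ys)" "(b, a) \<in> parcs G" "(b, c) \<in> parcs G" "c \<noteq> a"
    using Cons.prems(2) arc_sym[of a b] by (simp_all add: tpath_Cons_Cons)
  have "Trans b c a \<in> carrier_mat (\<rho> (b, c)) (\<rho> (a, b))"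
    using g p in_arcsD1[of b a] by (simp add: tqs_generator_dims_def neighbors_def)
  then have "obs_prod Out Trans (b # c # ys) * (Trans b c a * state_prod Inp Trans (b # a # xs)) =
      obs_prod Out Trans (b # c # ys) * Trans b c a * state_prod Inp Trans (b # a # xs)"
    by (rule assoc_mult_mat[symmetric, OF obs_prod_carrier[OF g p(1)] _ state_prod_carrier[OF g Cons.prems(1)]])
  then show ?case
    using Cons.IH[OF tpath_extend[OF p(3,4) Cons.prems(1)] p(1)] by simp
qed

section \<open>TQS matrices as edge factorizations\<close>

definition route :: "nat \<Rightarrow> nat \<Rightarrow> nat list" where
  "route x y = (THE q. tpath q \<and> hd q = x \<and> last q = y)"

lemma route_eq: "tpath q \<Longrightarrow> route (hd q) (last q) = q"
  unfolding route_def by (rule the_equality) (auto intro: tpath_unique)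

lemma route_side:
  assumes "k \<in> side a b"
  obtains xs where "tpath (b # a # xs)" "last (a # xs) = k" "route b k = b # a # xs"
proof -
  from assms obtain xs where xs: "tpath (b # a # xs)" "last (a # xs) = k"
    unfolding side_def by blast
  then have "route b k = b # a # xs" using route_eq[OF xs(1)] by simp
  then show thesis using that xs by blast
qed

text \<open>In terms of systems theory, \<open>\<Phi> a b\<close> is the reachability map and \<open>\<Psi> a b\<close> the observability map
  of the state on the edge from \<open>a\<close> to \<open>b\<close>. A recursion is imposed on \<open>\<Phi>\<close> only: path products are
  built from the input end, and at the output end the factorization across the last edge is
  enough.\<close>

definition edge_factorization ::
  "(nat \<Rightarrow> nat) \<Rightarrow> (nat \<Rightarrow> nat) \<Rightarrow> (nat \<times> nat \<Rightarrow> nat) \<Rightarrow> (nat \<Rightarrow> nat \<Rightarrow> 'a::semiring_0 mat) \<Rightarrow>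
   (nat \<Rightarrow> nat \<Rightarrow> nat \<Rightarrow> 'a mat) \<Rightarrow> (nat \<Rightarrow> nat \<Rightarrow> nat \<Rightarrow> 'a mat) \<Rightarrow> (nat \<Rightarrow> nat \<Rightarrow> nat \<Rightarrow> 'a mat) \<Rightarrow> bool"
  where
    "edge_factorization m n \<rho> B \<Phi> \<Psi> Trans \<longleftrightarrow>
      (\<forall>a b. (a, b) \<in> parcs G \<longrightarrow>
         (\<forall>j\<in>side a b. \<Phi> a b j \<in> carrier_mat (\<rho> (a, b)) (n j)) \<and>
         (\<forall>i\<in>side b a. \<Psi> a b i \<in> carrier_mat (m i) (\<rho> (a, b))) \<and>
         (\<forall>j\<in>side a b. \<forall>i\<in>side b a. B i j = \<Psi> a b i * \<Phi> a b j)) \<and>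
      (\<forall>j k i. (j, k) \<in> parcs G \<longrightarrow> (k, i) \<in> parcs G \<longrightarrow> i \<noteq> j \<longrightarrow>
         Trans k i j \<in> carrier_mat (\<rho> (k, i)) (\<rho> (j, k)) \<and>
         (\<forall>l\<in>side j k. \<Phi> k i l = Trans k i j * \<Phi> j k l))"

text \<open>The witnesses are the two halves of the path product along the unique path, cut at the edge in
  question. Passing to the next edge lengthens the path of the input half by one node, which
  contributes exactly one transition matrix.\<close>

lemma edge_factorization_if_tqs:
  assumes T: "is_tqs G m n \<rho> T"
  shows "\<exists>\<Phi> \<Psi> Trans. edge_factorization m n \<rho> (mat_block m n T) \<Phi> \<Psi> Trans"
proof -
  from T obtain D Inp Trans Out where g: "tqs_generator_dims G m n \<rho> D Inp Trans Out"
    and prod: "\<And>i j q. i \<in> pverts G \<Longrightarrow> j \<in> pverts G \<Longrightarrow> i \<noteq> j \<Longrightarrow> tpath q \<Longrightarrow> hd q = j \<Longrightarrow> last q = i \<Longrightarrow>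
      mat_block m n T i j = path_product Inp Trans Out q"
    unfolding is_tqs_def by blast
  let ?\<Phi> = "\<lambda>a b j. state_prod Inp Trans (route b j)"
  let ?\<Psi> = "\<lambda>a b i. obs_prod Out Trans (route a i)"
  have "edge_factorization m n \<rho> (mat_block m n T) ?\<Phi> ?\<Psi> Trans"
    unfolding edge_factorization_def
  proof (intro conjI allI impI ballI)
    fix a b j assume "j \<in> side a b"
    then show "?\<Phi> a b j \<in> carrier_mat (\<rho> (a, b)) (n j)"
      by (elim route_side) (use state_prod_carrier[OF g] in auto)
  next
    fix a b i assume "i \<in> side b a"
    then show "?\<Psi> a b i \<in> carrier_mat (m i) (\<rho> (a, b))"
      by (elim route_side) (use obs_prod_carrier[OF g] in auto)
  next
    fix a b j i assume ji: "j \<in> side a b" "i \<in> side b a"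
    obtain xs where x: "tpath (b # a # xs)" "last (a # xs) = j" "route b j = b # a # xs"
      using ji(1) by (rule route_side)
    obtain ys where y: "tpath (a # b # ys)" "last (b # ys) = i" "route a i = a # b # ys"
      using ji(2) by (rule route_side)
    have "mat_block m n T i j = path_product Inp Trans Out (rev (a # xs) @ b # ys)"
    proof (rule prod)
      show "i \<in> pverts G" "j \<in> pverts G" "i \<noteq> j"
        using ji side_subset side_disjoint[of a b] by blast+
      show "tpath (rev (a # xs) @ b # ys)" by (rule tpath_glue[OF x(1) y(1)])
      have "hd (rev (a # xs)) = j" using x(2) by (simp only: hd_rev)
      then show "hd (rev (a # xs) @ b # ys) = j" by (subst hd_append2) simp_all
      show "last (rev (a # xs) @ b # ys) = i" using y(2) by simp
    qed
    then show "mat_block m n T i j = ?\<Psi> a b i * ?\<Phi> a b j"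
      using path_product_cut[OF g x(1) y(1)] x(3) y(3) by simp
  next
    fix j k i assume jk: "(j, k) \<in> parcs G" and ki: "(k, i) \<in> parcs G" and ij: "i \<noteq> j"
    show "Trans k i j \<in> carrier_mat (\<rho> (k, i)) (\<rho> (j, k))"
      using g ki ij arc_sym[OF jk] in_arcsD1[OF ki] by (simp add: tqs_generator_dims_def neighbors_def)
    fix l assume "l \<in> side j k"
    then obtain xs where x: "tpath (k # j # xs)" "last (j # xs) = l" "route k l = k # j # xs"
      by (rule route_side)
    have "route i l = i # k # j # xs"
      using route_eq[OF tpath_extend[OF ki ij x(1)]] x(2) by simp
    then show "?\<Phi> k i l = Trans k i j * ?\<Phi> j k l" using x(3) by simp
  qed
  then show ?thesis by blast
qed

text \<open>An end point of an edge lies on its own side, so \<open>\<Phi> k j k\<close> and \<open>\<Psi> i k k\<close> can serve as \<open>Inp\<close> and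
  \<open>Out\<close>. By induction along a path the generators accumulate to \<open>\<Phi>\<close> on its last edge, and the
  factorization across that edge gives the block.\<close>

lemma tqs_if_edge_factorization:
  assumes T: "T \<in> carrier_mat (\<Sum>i\<in>pverts G. m i) (\<Sum>i\<in>pverts G. n i)"
    and f: "edge_factorization m n \<rho> (mat_block m n T) \<Phi> \<Psi> Trans"
  shows "is_tqs G m n \<rho> T"
proof -
  let ?D = "\<lambda>k. mat_block m n T k k"
  let ?Inp = "\<lambda>k j. \<Phi> k j k"
  let ?Out = "\<lambda>k i. \<Psi> i k k"
  have g: "tqs_generator_dims G m n \<rho> ?D ?Inp Trans ?Out"
    unfolding tqs_generator_dims_def
  proof (intro conjI allI impI ballI)
    fix k j assume kj: "(k, j) \<in> parcs G"
    then show "?Inp k j \<in> carrier_mat (\<rho> (k, j)) (n k)"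
      using f side_self[OF kj] by (simp add: edge_factorization_def)
  next
    fix k i assume ik: "(i, k) \<in> parcs G"
    then show "?Out k i \<in> carrier_mat (m k) (\<rho> (i, k))"
      using f side_self[OF arc_sym[OF ik]] by (simp add: edge_factorization_def)
  next
    fix k i j assume "i \<in> neighbors G k" "j \<in> neighbors G k" "i \<noteq> j"
    then show "Trans k i j \<in> carrier_mat (\<rho> (k, i)) (\<rho> (j, k))"
      using f arc_sym[of k j] by (simp add: edge_factorization_def neighbors_def)
  qed simp
  have state: "tpath (b # a # xs) \<Longrightarrow> state_prod ?Inp Trans (b # a # xs) = \<Phi> a b (last (a # xs))" for a b xs
  proof (induction xs arbitrary: a b)
    case (Cons c xs)
    then have p: "tpath (a # c # xs)" "(a, b) \<in> parcs G" "(c, a) \<in> parcs G" "b \<noteq> c"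
      using arc_sym[of b a] arc_sym[of a c] by (simp_all add: tpath_Cons_Cons)
    then have "last (c # xs) \<in> side c a" unfolding side_def by blast
    then have "\<Phi> a b (last (c # xs)) = Trans a b c * \<Phi> c a (last (c # xs))"
      using f p unfolding edge_factorization_def by blast
    then show ?case using Cons.IH[OF p(1)] by simp
  qed simp
  have "mat_block m n T i j = path_product ?Inp Trans ?Out q"
    if ij: "i \<noteq> j" and q: "tpath q" "hd q = j" "last q = i" for i j q
  proof -
    have "q \<noteq> []" using q(1) by (auto simp: vpath_def vwalk_def)
    have r: "tpath (rev q)" "hd (rev q) = i" "last (rev q) = j"
      using q \<open>q \<noteq> []\<close> by (simp_all add: tpath_rev hd_rev last_rev)
    obtain a xs where rev: "rev q = i # a # xs"
      using r ij \<open>q \<noteq> []\<close> by (cases "rev q" rule: vwalk_arcs.cases) auto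
    have p: "tpath (i # a # xs)" "last (a # xs) = j" using r unfolding rev by simp_all
    then have ai: "(a, i) \<in> parcs G" using arc_sym[of i a] by (simp add: tpath_Cons_Cons)
    have q_eq: "q = rev (i # a # xs)" using rev by (metis rev_rev_ident)
    have "j \<in> side a i" using p unfolding side_def by blast
    then have "mat_block m n T i j = \<Psi> a i i * \<Phi> a i j"
      using f ai side_self[OF arc_sym[OF ai]] unfolding edge_factorization_def by blast
    also have "\<dots> = path_product ?Inp Trans ?Out q"
      unfolding q_eq path_product_state state[OF p(1)] p(2) ..
    finally show ?thesis .
  qed
  then show ?thesis using T g unfolding is_tqs_def by blast
qed

section \<open>Products\<close>

text \<open>The state of the product on an edge stacks two parts: the state of \<open>T\<^sub>1\<close> caused by what \<open>T\<^sub>2\<close>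
  outputs on the near side of the edge, and the state of \<open>T\<^sub>2\<close>. What \<open>T\<^sub>2\<close> outputs on the far side is a
  function of its own state on the edge, which explains the second block of \<open>\<Psi>\<close>. The off-diagonal
  block of the transition matrix collects the nodes that branch off at \<open>k\<close>, including \<open>k\<close> itself:
  there the state of \<open>T\<^sub>2\<close> arriving from \<open>j\<close> is turned into inputs of \<open>T\<^sub>1\<close>.\<close>

lemma edge_factorization_mult:
  assumes f1: "edge_factorization m n \<rho>\<^sub>1 B\<^sub>1 \<Phi>\<^sub>1 \<Psi>\<^sub>1 Trans\<^sub>1"
    and f2: "edge_factorization n p \<rho>\<^sub>2 B\<^sub>2 \<Phi>\<^sub>2 \<Psi>\<^sub>2 Trans\<^sub>2"
    and B1: "\<And>i j. B\<^sub>1 i j \<in> carrier_mat (m i) (n j)"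
    and B2: "\<And>i j. B\<^sub>2 i j \<in> carrier_mat (n i) (p j)"
    and B: "\<And>i j. i \<in> pverts G \<Longrightarrow> j \<in> pverts G \<Longrightarrow>
      B i j = msum (m i) (p j) (\<lambda>k. B\<^sub>1 i k * B\<^sub>2 k j) (pverts G)"
  shows "edge_factorization m p (\<lambda>e. \<rho>\<^sub>1 e + \<rho>\<^sub>2 e) B
    (\<lambda>a b j. msum (\<rho>\<^sub>1 (a, b)) (p j) (\<lambda>k. \<Phi>\<^sub>1 a b k * B\<^sub>2 k j) (side a b) @\<^sub>r \<Phi>\<^sub>2 a b j)
    (\<lambda>a b i. append_cols (\<Psi>\<^sub>1 a b i) (msum (m i) (\<rho>\<^sub>2 (a, b)) (\<lambda>k. B\<^sub>1 i k * \<Psi>\<^sub>2 a b k) (side b a)))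
    (\<lambda>k i j. four_block_mat
       (Trans\<^sub>1 k i j)
       (msum (\<rho>\<^sub>1 (k, i)) (\<rho>\<^sub>2 (j, k)) (\<lambda>l. \<Phi>\<^sub>1 k i l * \<Psi>\<^sub>2 j k l) (side k i - side j k))
       (0\<^sub>m (\<rho>\<^sub>2 (k, i)) (\<rho>\<^sub>1 (j, k))) (Trans\<^sub>2 k i j))"
    (is "edge_factorization m p ?\<rho> B ?\<Phi> ?\<Psi> ?Trans")
proof -
  have \<Phi>1: "\<Phi>\<^sub>1 a b k \<in> carrier_mat (\<rho>\<^sub>1 (a, b)) (n k)" if "(a, b) \<in> parcs G" "k \<in> side a b" for a b k
    using f1 that by (simp add: edge_factorization_def)
  have \<Psi>1: "\<Psi>\<^sub>1 a b k \<in> carrier_mat (m k) (\<rho>\<^sub>1 (a, b))" if "(a, b) \<in> parcs G" "k \<in> side b a" for a b k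
    using f1 that by (simp add: edge_factorization_def)
  have fac1: "B\<^sub>1 i j = \<Psi>\<^sub>1 a b i * \<Phi>\<^sub>1 a b j" if "(a, b) \<in> parcs G" "j \<in> side a b" "i \<in> side b a" for a b i j
    using f1 that by (simp add: edge_factorization_def)
  have \<Phi>2: "\<Phi>\<^sub>2 a b k \<in> carrier_mat (\<rho>\<^sub>2 (a, b)) (p k)" if "(a, b) \<in> parcs G" "k \<in> side a b" for a b k
    using f2 that by (simp add: edge_factorization_def)
  have \<Psi>2: "\<Psi>\<^sub>2 a b k \<in> carrier_mat (n k) (\<rho>\<^sub>2 (a, b))" if "(a, b) \<in> parcs G" "k \<in> side b a" for a b k
    using f2 that by (simp add: edge_factorization_def)
  have fac2: "B\<^sub>2 i j = \<Psi>\<^sub>2 a b i * \<Phi>\<^sub>2 a b j" if "(a, b) \<in> parcs G" "j \<in> side a b" "i \<in> side b a" for a b i j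
    using f2 that by (simp add: edge_factorization_def)
  have fin: "finite (side a b)" for a b
    using side_subset pair_finite_verts by (rule finite_subset)
  show ?thesis
    unfolding edge_factorization_def
  proof (intro conjI allI impI ballI)
    fix a b j assume ab: "(a, b) \<in> parcs G" and j: "j \<in> side a b"
    then show "?\<Phi> a b j \<in> carrier_mat (\<rho>\<^sub>1 (a, b) + \<rho>\<^sub>2 (a, b)) (p j)"
      using \<Phi>2 by (intro carrier_append_rows) simp_all
  next
    fix a b i assume ab: "(a, b) \<in> parcs G" and i: "i \<in> side b a"
    then show "?\<Psi> a b i \<in> carrier_mat (m i) (\<rho>\<^sub>1 (a, b) + \<rho>\<^sub>2 (a, b))"
      using \<Psi>1 by (intro append_cols_carrier) simp_all
  next
    fix a b j i assume ab: "(a, b) \<in> parcs G" and j: "j \<in> side a b" and i: "i \<in> side b a"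
    let ?S = "msum (\<rho>\<^sub>1 (a, b)) (p j) (\<lambda>k. \<Phi>\<^sub>1 a b k * B\<^sub>2 k j) (side a b)"
    let ?O = "msum (m i) (\<rho>\<^sub>2 (a, b)) (\<lambda>k. B\<^sub>1 i k * \<Psi>\<^sub>2 a b k) (side b a)"
    \<comment> \<open>For \<open>k\<close> on the near side it is the block of the first matrix that crosses the edge.\<close>
    have "\<Psi>\<^sub>1 a b i * ?S = msum (m i) (p j) (\<lambda>k. \<Psi>\<^sub>1 a b i * (\<Phi>\<^sub>1 a b k * B\<^sub>2 k j)) (side a b)"
      using \<Psi>1[OF ab i] by (rule mult_msum) (rule mult_carrier_mat[OF \<Phi>1[OF ab] B2])
    also have "\<dots> = msum (m i) (p j) (\<lambda>k. B\<^sub>1 i k * B\<^sub>2 k j) (side a b)"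
      using assoc_mult_mat[OF \<Psi>1[OF ab i] \<Phi>1[OF ab] B2] fac1[OF ab _ i] by (intro msum_cong) simp
    finally have in_a: "\<Psi>\<^sub>1 a b i * ?S = \<dots>" .
    \<comment> \<open>For \<open>k\<close> on the far side it is the block of the second matrix.\<close>
    have "?O * \<Phi>\<^sub>2 a b j = msum (m i) (p j) (\<lambda>k. (B\<^sub>1 i k * \<Psi>\<^sub>2 a b k) * \<Phi>\<^sub>2 a b j) (side b a)"
      using \<Phi>2[OF ab j] by (rule msum_mult) (rule mult_carrier_mat[OF B1 \<Psi>2[OF ab]])
    also have "\<dots> = msum (m i) (p j) (\<lambda>k. B\<^sub>1 i k * B\<^sub>2 k j) (side b a)"
      using assoc_mult_mat[OF B1 \<Psi>2[OF ab] \<Phi>2[OF ab j]] fac2[OF ab j] by (intro msum_cong) simp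
    finally have in_b: "?O * \<Phi>\<^sub>2 a b j = \<dots>" .
    have "?\<Psi> a b i * ?\<Phi> a b j = \<Psi>\<^sub>1 a b i * ?S + ?O * \<Phi>\<^sub>2 a b j"
      by (rule append_cols_mult_append_rows[OF \<Psi>1[OF ab i] msum_carrier msum_carrier \<Phi>2[OF ab j]])
    also have "\<dots> = msum (m i) (p j) (\<lambda>k. B\<^sub>1 i k * B\<^sub>2 k j) (side a b \<union> side b a)"
      unfolding in_a in_b by (rule msum_union[symmetric, OF fin fin side_disjoint])
    also have "\<dots> = B i j"
      unfolding side_union[OF ab] by (rule B[symmetric]) (use i j side_subset in blast)+
    finally show "B i j = ?\<Psi> a b i * ?\<Phi> a b j" ..
  next
    fix j k i assume jk: "(j, k) \<in> parcs G" and ki: "(k, i) \<in> parcs G" and ij: "i \<noteq> j"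
    have T1: "Trans\<^sub>1 k i j \<in> carrier_mat (\<rho>\<^sub>1 (k, i)) (\<rho>\<^sub>1 (j, k))"
      and tr1: "\<And>l. l \<in> side j k \<Longrightarrow> \<Phi>\<^sub>1 k i l = Trans\<^sub>1 k i j * \<Phi>\<^sub>1 j k l"
      using f1 jk ki ij by (simp_all add: edge_factorization_def)
    have T2: "Trans\<^sub>2 k i j \<in> carrier_mat (\<rho>\<^sub>2 (k, i)) (\<rho>\<^sub>2 (j, k))"
      and tr2: "\<And>l. l \<in> side j k \<Longrightarrow> \<Phi>\<^sub>2 k i l = Trans\<^sub>2 k i j * \<Phi>\<^sub>2 j k l"
      using f2 jk ki ij by (simp_all add: edge_factorization_def)
    show "?Trans k i j \<in> carrier_mat (\<rho>\<^sub>1 (k, i) + \<rho>\<^sub>2 (k, i)) (\<rho>\<^sub>1 (j, k) + \<rho>\<^sub>2 (j, k))"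
      using T1 T2 by (rule four_block_carrier_mat)
    fix l assume l: "l \<in> side j k"
    let ?U = "side k i - side j k"
    let ?S = "msum (\<rho>\<^sub>1 (j, k)) (p l) (\<lambda>r. \<Phi>\<^sub>1 j k r * B\<^sub>2 r l) (side j k)"
    let ?X = "msum (\<rho>\<^sub>1 (k, i)) (\<rho>\<^sub>2 (j, k)) (\<lambda>r. \<Phi>\<^sub>1 k i r * \<Psi>\<^sub>2 j k r) ?U"
    \<comment> \<open>A node branching off at \<open>k\<close> lies before \<open>(k, i)\<close> and behind \<open>(j, k)\<close>: it receives the state of the
      second matrix on \<open>(j, k)\<close> and feeds the state of the first matrix on \<open>(k, i)\<close>.\<close>
    have U: "r \<in> side k i" "r \<in> side k j" if "r \<in> ?U" for r
      using that side_subset side_union[OF jk] by blast+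
    have "Trans\<^sub>1 k i j * ?S =
        msum (\<rho>\<^sub>1 (k, i)) (p l) (\<lambda>r. Trans\<^sub>1 k i j * (\<Phi>\<^sub>1 j k r * B\<^sub>2 r l)) (side j k)"
      using T1 by (rule mult_msum) (rule mult_carrier_mat[OF \<Phi>1[OF jk] B2])
    also have "\<dots> = msum (\<rho>\<^sub>1 (k, i)) (p l) (\<lambda>r. \<Phi>\<^sub>1 k i r * B\<^sub>2 r l) (side j k)"
      using assoc_mult_mat[OF T1 \<Phi>1[OF jk] B2] tr1 by (intro msum_cong) simp
    finally have old: "Trans\<^sub>1 k i j * ?S = \<dots>" .
    have "?X * \<Phi>\<^sub>2 j k l = msum (\<rho>\<^sub>1 (k, i)) (p l) (\<lambda>r. (\<Phi>\<^sub>1 k i r * \<Psi>\<^sub>2 j k r) * \<Phi>\<^sub>2 j k l) ?U"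
      using \<Phi>2[OF jk l] by (rule msum_mult) (rule mult_carrier_mat[OF \<Phi>1[OF ki U(1)] \<Psi>2[OF jk U(2)]])
    also have "\<dots> = msum (\<rho>\<^sub>1 (k, i)) (p l) (\<lambda>r. \<Phi>\<^sub>1 k i r * B\<^sub>2 r l) ?U"
      using assoc_mult_mat[OF \<Phi>1[OF ki U(1)] \<Psi>2[OF jk U(2)] \<Phi>2[OF jk l]] fac2[OF jk l U(2)]
      by (intro msum_cong) simp
    finally have new: "?X * \<Phi>\<^sub>2 j k l = \<dots>" .
    have "?Trans k i j * ?\<Phi> j k l =
        (Trans\<^sub>1 k i j * ?S + ?X * \<Phi>\<^sub>2 j k l) @\<^sub>r
        (0\<^sub>m (\<rho>\<^sub>2 (k, i)) (\<rho>\<^sub>1 (j, k)) * ?S + Trans\<^sub>2 k i j * \<Phi>\<^sub>2 j k l)"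
      by (rule four_block_mult_append_rows[OF T1 msum_carrier zero_carrier_mat T2 msum_carrier \<Phi>2[OF jk l]])
    also have "Trans\<^sub>1 k i j * ?S + ?X * \<Phi>\<^sub>2 j k l =
        msum (\<rho>\<^sub>1 (k, i)) (p l) (\<lambda>r. \<Phi>\<^sub>1 k i r * B\<^sub>2 r l) (side j k \<union> ?U)"
      unfolding old new by (rule msum_union[symmetric]) (simp_all add: fin Diff_disjoint)
    also have "side j k \<union> ?U = side k i"
      using side_mono[OF ki ij] by blast
    also have "0\<^sub>m (\<rho>\<^sub>2 (k, i)) (\<rho>\<^sub>1 (j, k)) * ?S + Trans\<^sub>2 k i j * \<Phi>\<^sub>2 j k l = \<Phi>\<^sub>2 k i l"
      using tr2[OF l] mult_carrier_mat[OF T2 \<Phi>2[OF jk l]]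
      by (simp add: left_mult_zero_mat[OF msum_carrier])
    finally show "?\<Phi> k i l = ?Trans k i j * ?\<Phi> j k l" ..
  qed
qed

end

theorem proposition4p7:
  fixes G :: "nat pair_pre_digraph"
    and K :: nat
    and m n p :: "nat \<Rightarrow> nat"
    and \<rho>\<^sub>1 \<rho>\<^sub>2 :: "nat \<times> nat \<Rightarrow> nat"
    and T\<^sub>1 T\<^sub>2 :: "'a::field mat"
  assumes "tree_graph G K"
    and "is_tqs G m n \<rho>\<^sub>1 T\<^sub>1"
    and "is_tqs G n p \<rho>\<^sub>2 T\<^sub>2"
  shows "is_tqs G m p (\<lambda>e. \<rho>\<^sub>1 e + \<rho>\<^sub>2 e) (T\<^sub>1 * T\<^sub>2)"
proof -
  interpret tree_graph G K by fact
  have T1: "T\<^sub>1 \<in> carrier_mat (\<Sum>i\<in>pverts G. m i) (\<Sum>i\<in>pverts G. n i)"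
    and T2: "T\<^sub>2 \<in> carrier_mat (\<Sum>i\<in>pverts G. n i) (\<Sum>i\<in>pverts G. p i)"
    using assms(2,3) by (simp_all add: is_tqs_def)
  obtain \<Phi>\<^sub>1 \<Psi>\<^sub>1 Trans\<^sub>1 where f1: "edge_factorization m n \<rho>\<^sub>1 (mat_block m n T\<^sub>1) \<Phi>\<^sub>1 \<Psi>\<^sub>1 Trans\<^sub>1"
    using edge_factorization_if_tqs[OF assms(2)] by blast
  obtain \<Phi>\<^sub>2 \<Psi>\<^sub>2 Trans\<^sub>2 where f2: "edge_factorization n p \<rho>\<^sub>2 (mat_block n p T\<^sub>2) \<Phi>\<^sub>2 \<Psi>\<^sub>2 Trans\<^sub>2"
    using edge_factorization_if_tqs[OF assms(3)] by blast
  have "mat_block m p (T\<^sub>1 * T\<^sub>2) i j =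
      msum (m i) (p j) (\<lambda>k. mat_block m n T\<^sub>1 i k * mat_block n p T\<^sub>2 k j) (pverts G)"
    if "i \<in> pverts G" "j \<in> pverts G" for i j
    using T1 T2 that unfolding verts_eq by (rule mat_block_mult)
  then show ?thesis
    by (rule tqs_if_edge_factorization[OF mult_carrier_mat[OF T1 T2]
        edge_factorization_mult[OF f1 f2 mat_block_carrier mat_block_carrier]])
qed

end
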